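(* Let $G$ be a connected $P_5$-free chordal bipartite graph. Then $G$ is Hamiltonian if and only if $G$ is homogeneously traceable.
   Context: Graphs are finite, simple and undirected. A bipartite graph is chordal bipartite if every cycle of length at least six has a chord. $P_5$-free means no induced path on five vertices. A graph is homogeneously traceable if for every vertex $v$ there is a Hamiltonian path beginning at $v$.
   Formalization: The graph G is additionally assumed to have at least three vertices, since the one-vertex graph and the single edge are homogeneously traceable but contain no cycle and so are not Hamiltonian. *)

theory Defs
  imports "Graph_Theory.Graph_Theory"
begin

text \<open>
  A finite simple undirected graph is a \<^locale>\<open>graph\<close>: a finite, loop-free, symmetric digraph
  without parallel arcs, the two arcs between adjacent vertices standing for one undirected edge.
  On such graphs \<^const>\<open>connected\<close> is ordinary connectedness; it excludes the graph without vertices.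
\<close>

definition bipartite :: "('a, 'b) pre_digraph \<Rightarrow> bool" where
  "bipartite G \<longleftrightarrow> (\<exists>X Y. verts G = X \<union> Y \<and> X \<inter> Y = {} \<and>
     (\<forall>u v. u \<rightarrow>\<^bsub>G\<^esub> v \<longrightarrow> (u \<in> X \<and> v \<in> Y) \<or> (u \<in> Y \<and> v \<in> X)))"

text \<open>
  A cycle is the list of its vertices, without repeating the first one at the end. The library's
  \<^const>\<open>pre_digraph.cycle\<close> is not used since it admits going back and forth along one edge.
\<close>

definition vcycle :: "'a list \<Rightarrow> ('a, 'b) pre_digraph \<Rightarrow> bool" where
  "vcycle c G \<longleftrightarrow> vpath c G \<and> 3 \<le> length c \<and> last c \<rightarrow>\<^bsub>G\<^esub> hd c"

definition vcycle_arcs :: "'a list \<Rightarrow> ('a \<times> 'a) set" where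
  "vcycle_arcs c = set (vwalk_arcs (c @ [hd c]))"

text \<open>The list of arcs of a cycle has only one of the two orientations of each edge.\<close>

definition has_chord :: "'a list \<Rightarrow> ('a, 'b) pre_digraph \<Rightarrow> bool" where
  "has_chord c G \<longleftrightarrow> (\<exists>u \<in> set c. \<exists>v \<in> set c.
     u \<rightarrow>\<^bsub>G\<^esub> v \<and> (u, v) \<notin> vcycle_arcs c \<and> (v, u) \<notin> vcycle_arcs c)"

definition chordal_bipartite :: "('a, 'b) pre_digraph \<Rightarrow> bool" where
  "chordal_bipartite G \<longleftrightarrow>
     bipartite G \<and> (\<forall>c. vcycle c G \<and> 6 \<le> length c \<longrightarrow> has_chord c G)"

definition induced_vpath :: "'a list \<Rightarrow> ('a, 'b) pre_digraph \<Rightarrow> bool" where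
  "induced_vpath p G \<longleftrightarrow> vpath p G \<and> (\<forall>u \<in> set p. \<forall>v \<in> set p.
     u \<rightarrow>\<^bsub>G\<^esub> v \<longrightarrow> (u, v) \<in> set (vwalk_arcs p) \<or> (v, u) \<in> set (vwalk_arcs p))"

definition P5_free :: "('a, 'b) pre_digraph \<Rightarrow> bool" where
  "P5_free G \<longleftrightarrow> \<not> (\<exists>p. induced_vpath p G \<and> length p = 5)"

definition hamiltonian :: "('a, 'b) pre_digraph \<Rightarrow> bool" where
  "hamiltonian G \<longleftrightarrow> (\<exists>c. vcycle c G \<and> set c = verts G)"

definition hamiltonian_vpath :: "'a list \<Rightarrow> ('a, 'b) pre_digraph \<Rightarrow> bool" where
  "hamiltonian_vpath p G \<longleftrightarrow> vpath p G \<and> set p = verts G"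

definition homogeneously_traceable :: "('a, 'b) pre_digraph \<Rightarrow> bool" where
  "homogeneously_traceable G \<longleftrightarrow> (\<forall>v \<in> verts G. \<exists>p. hamiltonian_vpath p G \<and> hd p = v)"

end

theory Submission
  imports Defs
begin

text \<open>
  In a connected \<open>P\<^sub>5\<close>-free bipartite graph, the neighbourhoods of the vertices of one part are nested:
  two incomparable neighbourhoods of vertices with a common neighbour give an induced \<open>P\<^sub>5\<close>. Hence some
  vertex \<open>x\<close> is adjacent to the whole other part. Hamiltonian paths starting in each of the two parts
  force the parts to have equal size, so a Hamiltonian path starting at \<open>x\<close> ends in the other part
  and closes up to a Hamiltonian cycle.
\<close>

text \<open>The body of \<open>bipartite\<close> with the two parts made explicit, so that facts can
  refer to one given part and be reused with the parts exchanged.\<close>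

definition bipartition :: "('a, 'b) pre_digraph \<Rightarrow> 'a set \<Rightarrow> 'a set \<Rightarrow> bool" where
  "bipartition G X Y \<longleftrightarrow> verts G = X \<union> Y \<and> X \<inter> Y = {} \<and>
     (\<forall>u v. u \<rightarrow>\<^bsub>G\<^esub> v \<longrightarrow> (u \<in> X \<and> v \<in> Y) \<or> (u \<in> Y \<and> v \<in> X))"

lemma bipartition_sym: "bipartition G X Y \<Longrightarrow> bipartition G Y X"
  unfolding bipartition_def by blast

text \<open>Otherwise \<open>a, x, y, x', b\<close> is an induced path: both remaining pairs across
  the parts, \<open>a, x'\<close> and \<open>x, b\<close>, are non-adjacent, and no edge joins
  vertices of the same part.\<close>

lemma P5_free_common_neighbour:
  assumes "graph G" and "P5_free G" and bip: "bipartition G X Y"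
    and "x \<rightarrow>\<^bsub>G\<^esub> y" "x' \<rightarrow>\<^bsub>G\<^esub> y"
    and "x \<rightarrow>\<^bsub>G\<^esub> a" "\<not> x' \<rightarrow>\<^bsub>G\<^esub> a" "x' \<rightarrow>\<^bsub>G\<^esub> b"
  shows "x \<rightarrow>\<^bsub>G\<^esub> b"
proof (rule ccontr)
  assume nb: "\<not> x \<rightarrow>\<^bsub>G\<^esub> b"
  interpret graph G by fact
  have sym: "v \<rightarrow>\<^bsub>G\<^esub> u" if "u \<rightarrow>\<^bsub>G\<^esub> v" for u v
    using sym_arcs that by (rule arcs_ends_symmetric)
  have arcs: "a \<rightarrow>\<^bsub>G\<^esub> x" "x \<rightarrow>\<^bsub>G\<^esub> y" "y \<rightarrow>\<^bsub>G\<^esub> x'" "x' \<rightarrow>\<^bsub>G\<^esub> b"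
    using assms sym by auto
  have cross: "(u \<in> X \<and> v \<in> Y) \<or> (u \<in> Y \<and> v \<in> X)" if "u \<rightarrow>\<^bsub>G\<^esub> v" for u v
    using bip that unfolding bipartition_def by blast
  have disj: "u \<notin> Y" if "u \<in> X" for u
    using bip that unfolding bipartition_def by blast
  have parts: "(x \<in> X \<and> x' \<in> X \<and> a \<in> Y \<and> y \<in> Y \<and> b \<in> Y) \<or>
      (x \<in> Y \<and> x' \<in> Y \<and> a \<in> X \<and> y \<in> X \<and> b \<in> X)"
    using cross[OF arcs(1)] cross[OF arcs(2)] cross[OF arcs(3)] cross[OF arcs(4)] disj by blast
  have same: "\<not> u \<rightarrow>\<^bsub>G\<^esub> v" if "(u \<in> X \<and> v \<in> X) \<or> (u \<in> Y \<and> v \<in> Y)" for u v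
    using that cross[of u v] disj by blast
  let ?p = "[a, x, y, x', b]"
  \<comment> \<open>Vertices of the same part differ because some vertex is adjacent to exactly one
    of them: \<open>a\<close> separates \<open>x\<close> from \<open>x'\<close>, \<open>x\<close>
    separates \<open>b\<close> from \<open>a\<close> and \<open>y\<close>, and \<open>x'\<close>
    separates \<open>a\<close> from \<open>y\<close>.\<close>
  have "distinct ?p"
    using parts disj assms nb by auto
  moreover have "vwalk ?p G"
    using arcs by (auto simp: vwalk_def adj_in_verts)
  moreover have "\<not> a \<rightarrow>\<^bsub>G\<^esub> x'" "\<not> b \<rightarrow>\<^bsub>G\<^esub> x"
    using assms(7) nb sym by blast+
  moreover have "\<not> u \<rightarrow>\<^bsub>G\<^esub> v" if "{u, v} \<subseteq> {x, x'} \<or> {u, v} \<subseteq> {a, y, b}" for u v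
    by (rule same) (use that parts in blast)
  ultimately have "\<forall>u \<in> set ?p. \<forall>v \<in> set ?p.
      u \<rightarrow>\<^bsub>G\<^esub> v \<longrightarrow> (u, v) \<in> set (vwalk_arcs ?p) \<or> (v, u) \<in> set (vwalk_arcs ?p)"
    using \<open>\<not> x' \<rightarrow>\<^bsub>G\<^esub> a\<close> nb by simp
  with \<open>distinct ?p\<close> \<open>vwalk ?p G\<close> have "induced_vpath ?p G"
    unfolding induced_vpath_def vpath_def by blast
  then show False
    using \<open>P5_free G\<close> unfolding P5_free_def by auto
qed

text \<open>A vertex of maximum degree in \<open>X\<close> works: nestedness makes its neighbourhood
  contain that of every vertex of \<open>X\<close> reached from it, and connectedness reaches
  everything.\<close>

lemma exists_vertex_dominating_part:
  assumes "graph G" and "connected G" and "P5_free G" and bip: "bipartition G X Y"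
    and "X \<noteq> {}"
  obtains x where "x \<in> X" and "\<And>y. y \<in> Y \<Longrightarrow> x \<rightarrow>\<^bsub>G\<^esub> y"
proof -
  interpret graph G by fact
  define N where "N u = {v. u \<rightarrow>\<^bsub>G\<^esub> v}" for u
  have fin_N: "finite (N u)" for u
    by (rule finite_subset[OF _ finite_verts]) (auto simp: N_def adj_in_verts)
  have "finite X"
    using bip finite_verts unfolding bipartition_def by simp
  then have "Max ((card \<circ> N) ` X) \<in> (card \<circ> N) ` X"
    using \<open>X \<noteq> {}\<close> by (intro Max_in) auto
  then obtain x where x: "x \<in> X" and "card (N x) = Max ((card \<circ> N) ` X)"
    by auto
  then have max: "card (N u) \<le> card (N x)" if "u \<in> X" for u
    using \<open>finite X\<close> that by simp
  \<comment> \<open>\<open>C\<close> contains \<open>x\<close> and is closed under adjacency, so it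
    is the whole vertex set; its elements outside \<open>X\<close> can only lie in
    \<open>N x\<close>.\<close>
  define C where "C = {u \<in> X. N u \<subseteq> N x} \<union> N x"
  have closed: "v \<in> C" if "u \<in> C" "u \<rightarrow>\<^bsub>G\<^esub> v" for u v
  proof (cases "u \<in> N x")
    case False
    with that show ?thesis by (auto simp: C_def N_def)
  next
    case True
    then have "x \<rightarrow>\<^bsub>G\<^esub> u" "v \<rightarrow>\<^bsub>G\<^esub> u"
      using arcs_ends_symmetric[OF sym_arcs that(2)] by (simp_all add: N_def)
    have "v \<in> X"
      using bip x \<open>x \<rightarrow>\<^bsub>G\<^esub> u\<close> \<open>v \<rightarrow>\<^bsub>G\<^esub> u\<close> unfolding bipartition_def by blast
    moreover have "N v \<subseteq> N x"
    \<comment> \<open>If \<open>N x\<close> is contained in \<open>N v\<close>, maximality of its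
      size forces equality. If not, a vertex of \<open>N x\<close> outside \<open>N v\<close> plays
      the role of \<open>a\<close> for the common neighbour \<open>u\<close>.\<close>
    proof (cases "N x \<subseteq> N v")
      case True
      then show ?thesis
        using max[OF \<open>v \<in> X\<close>] card_seteq[OF fin_N] by blast
    next
      case False
      then obtain a where "x \<rightarrow>\<^bsub>G\<^esub> a" "\<not> v \<rightarrow>\<^bsub>G\<^esub> a"
        by (auto simp: N_def)
      then show ?thesis
        using P5_free_common_neighbour[OF \<open>graph G\<close> \<open>P5_free G\<close> bip \<open>x \<rightarrow>\<^bsub>G\<^esub> u\<close> \<open>v \<rightarrow>\<^bsub>G\<^esub> u\<close>]
        by (auto simp: N_def)
    qed
    ultimately show ?thesis by (simp add: C_def)
  qed
  have "x \<rightarrow>\<^bsub>G\<^esub> y" if "y \<in> Y" for y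
  proof -
    have "x \<in> verts G" "y \<in> verts G"
      using bip x that unfolding bipartition_def by auto
    then have "x \<rightarrow>\<^sup>*\<^bsub>G\<^esub> y"
      using symmetric_connected_imp_strongly_connected[OF sym_arcs \<open>connected G\<close>]
      by (auto simp: strongly_connected_def)
    then have "y \<in> C"
    proof (induction rule: reachable_induct)
      case base
      then show ?case by (simp add: C_def x)
    next
      case (step u v)
      then show ?case by (blast intro: closed)
    qed
    moreover have "y \<notin> X"
      using bip that unfolding bipartition_def by blast
    ultimately show ?thesis
      by (simp add: C_def N_def)
  qed
  with x show ?thesis by (rule that)
qed

text \<open>The path switches parts at every arc. Induction is over all \<open>X\<close> and
  \<open>Y\<close> because the tail starts in the opposite part.\<close>

lemma alternating_vpath:
  assumes "bipartition G X Y" and "vpath p G" and "hd p \<in> X"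
  shows "card (set p \<inter> X) = (length p + 1) div 2"
    and "last p \<in> (if even (length p) then Y else X)"
proof -
  have "card (set p \<inter> X) = (length p + 1) div 2 \<and> last p \<in> (if even (length p) then Y else X)"
    using assms
  proof (induction p arbitrary: X Y)
    case Nil
    then show ?case by (simp add: vpath_def vwalk_def)
  next
    case (Cons u p)
    show ?case
    proof (cases "p = []")
      case True
      with Cons.prems show ?thesis by simp
    next
      case False
      have disj: "X \<inter> Y = {}" and sub: "set (u # p) \<subseteq> X \<union> Y"
        using Cons.prems unfolding bipartition_def vpath_def vwalk_def by auto
      have "u \<rightarrow>\<^bsub>G\<^esub> hd p" "vpath p G"
        using Cons.prems(2) False by (auto simp: vpath_def elim: vwalk_consE)
      moreover from this have "hd p \<in> Y"
        using Cons.prems(1,3) unfolding bipartition_def by auto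
      ultimately have IH: "card (set p \<inter> Y) = (length p + 1) div 2"
          "last p \<in> (if even (length p) then X else Y)"
        using Cons.IH[OF bipartition_sym[OF Cons.prems(1)]] by auto
      have p: "distinct p" "u \<notin> set p" "u \<in> X"
        using Cons.prems by (auto simp: vpath_def)
      have "set p = (set p \<inter> X) \<union> (set p \<inter> Y)"
        using sub by auto
      then have "length p = card ((set p \<inter> X) \<union> (set p \<inter> Y))"
        using distinct_card[OF p(1)] by simp
      also have "\<dots> = card (set p \<inter> X) + card (set p \<inter> Y)"
        using disj by (intro card_Un_disjoint) auto
      finally have "length p = card (set p \<inter> X) + card (set p \<inter> Y)" .
      moreover have "set (u # p) \<inter> X = insert u (set p \<inter> X)"
        using p by auto
      \<comment> \<open>The tail has \<open>(length p + 1) div 2\<close> vertices in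
        \<open>Y\<close>, hence \<open>length p div 2\<close> in \<open>X\<close>; \<open>u\<close>
        adds one more.\<close>
      ultimately have "card (set (u # p) \<inter> X) = (length (u # p) + 1) div 2"
        using IH(1) p by simp
      moreover have "last (u # p) \<in> (if even (length (u # p)) then Y else X)"
        using IH(2) False by (auto split: if_splits)
      ultimately show ?thesis ..
    qed
  qed
  then show "card (set p \<inter> X) = (length p + 1) div 2"
    and "last p \<in> (if even (length p) then Y else X)"
    by blast+
qed

text \<open>Rotating a Hamiltonian cycle to start at \<open>v\<close> gives the path.\<close>

lemma hamiltonian_imp_homogeneously_traceable:
  assumes "hamiltonian G"
  shows "homogeneously_traceable G"
  unfolding homogeneously_traceable_def
proof
  fix v
  assume "v \<in> verts G"
  obtain c where c: "vpath c G" "last c \<rightarrow>\<^bsub>G\<^esub> hd c" "set c = verts G"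
    using assms unfolding hamiltonian_def vcycle_def by blast
  with \<open>v \<in> verts G\<close> obtain a b where ab: "c = a @ v # b"
    by (metis split_list)
  have "vwalk ((v # b) @ a) G"
  proof (cases "a = []")
    case True
    with c ab show ?thesis by (simp add: vpath_def)
  next
    \<comment> \<open>The closing arc of \<open>c\<close> joins the end of \<open>v # b\<close> to
      the start of \<open>a\<close>.\<close>
    case False
    with c ab show ?thesis
      by (auto simp: vpath_def vwalk_def vwalk_arcs_append simp flip: append_Cons)
  qed
  then have "hamiltonian_vpath (v # b @ a) G"
    using c ab unfolding hamiltonian_vpath_def vpath_def by auto
  then show "\<exists>p. hamiltonian_vpath p G \<and> hd p = v"
    by (metis list.sel(1))
qed

text \<open>The bound on the number of vertices excludes a single vertex and a single edge, which
  are homogeneously traceable but have no cycle.\<close>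

lemma P5_free_bipartite_homogeneously_traceable_imp_hamiltonian:
  assumes "graph G" and card: "3 \<le> card (verts G)" and "connected G" and "P5_free G"
    and "bipartite G" and traceable: "homogeneously_traceable G"
  shows "hamiltonian G"
proof -
  interpret graph G by fact
  have "verts G \<noteq> {}"
    using card by auto
  moreover obtain X0 Y0 where "bipartition G X0 Y0"
    using \<open>bipartite G\<close> unfolding bipartite_def bipartition_def by blast
  ultimately have "X0 \<noteq> {} \<or> Y0 \<noteq> {}"
    unfolding bipartition_def by auto
  with \<open>bipartition G X0 Y0\<close> obtain X Y where bip: "bipartition G X Y" and "X \<noteq> {}"
    using bipartition_sym by blast
  then obtain x where "x \<in> X" and dom: "\<And>y. y \<in> Y \<Longrightarrow> x \<rightarrow>\<^bsub>G\<^esub> y"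
    using exists_vertex_dominating_part[OF \<open>graph G\<close> \<open>connected G\<close> \<open>P5_free G\<close>] by blast
  have verts: "verts G = X \<union> Y" "X \<inter> Y = {}"
    using bip unfolding bipartition_def by auto
  have path: thesis
    if "v \<in> verts G"
      and "\<And>p. vpath p G \<Longrightarrow> set p = verts G \<Longrightarrow> hd p = v \<Longrightarrow> length p = card (verts G) \<Longrightarrow> thesis"
    for v thesis
  proof -
    obtain p where p: "hamiltonian_vpath p G" "hd p = v"
      using traceable \<open>v \<in> verts G\<close> unfolding homogeneously_traceable_def by blast
    then have "vpath p G" "set p = verts G"
      by (simp_all add: hamiltonian_vpath_def)
    moreover from this have "length p = card (verts G)"
      using distinct_card[of p] by (simp add: vpath_def)
    ultimately show thesis
      using that(2) p(2) by simp
  qed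
  have "x \<in> verts G"
    using verts(1) \<open>x \<in> X\<close> by simp
  then obtain p where p: "vpath p G" "set p = verts G" "hd p = x" "length p = card (verts G)"
    by (rule path)
  have alt: "card X = (length p + 1) div 2" "last p \<in> (if even (length p) then Y else X)"
    using alternating_vpath[OF bip p(1)] p(2,3) verts(1) \<open>x \<in> X\<close> by (simp_all add: Int_absorb1)
  have card_verts: "length p = card X + card Y"
    using p(4) verts finite_verts card_Un_disjoint[of X Y] by simp
  \<comment> \<open>If the length were odd, the path from \<open>x\<close> would make
    \<open>X\<close> the larger part by one vertex, while a path from a vertex of \<open>Y\<close>
    would make \<open>Y\<close> the larger.\<close>
  have "even (length p)"
  proof (rule ccontr)
    assume odd: "odd (length p)"
    \<comment> \<open>With \<open>Y\<close> empty, \<open>n = (n + 1) div 2\<close> would hold for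
      the number \<open>n\<close> of vertices, which fails for \<open>n\<close> at least 3.\<close>
    have "card Y \<noteq> 0"
      using card_verts alt(1) card p(4) by presburger
    then obtain y where "y \<in> Y"
      by fastforce
    then have "y \<in> verts G"
      using verts(1) by simp
    then obtain q where q: "vpath q G" "set q = verts G" "hd q = y" "length q = card (verts G)"
      by (rule path)
    have "card Y = (length p + 1) div 2"
      using alternating_vpath(1)[OF bipartition_sym[OF bip] q(1)] q(2-4) p(4) verts(1) \<open>y \<in> Y\<close>
      by (simp add: Int_absorb1)
    with odd alt(1) card_verts show False
      by presburger
  qed
  \<comment> \<open>By parity the path ends in \<open>Y\<close>, all of which is adjacent to its
    first vertex \<open>x\<close>.\<close>
  then have "last p \<rightarrow>\<^bsub>G\<^esub> hd p"
    using alt(2) dom p(3) arcs_ends_symmetric[OF sym_arcs] by simp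
  then have "vcycle p G"
    using p card by (simp add: vcycle_def)
  with p(2) show ?thesis
    unfolding hamiltonian_def by blast
qed

theorem theorem8:
  fixes G :: "('a, 'b) pre_digraph"
  assumes "graph G"
    and "3 \<le> card (verts G)"
    and "connected G"
    and "P5_free G"
    and "chordal_bipartite G"
  shows "hamiltonian G \<longleftrightarrow> homogeneously_traceable G"
  using assms hamiltonian_imp_homogeneously_traceable
    P5_free_bipartite_homogeneously_traceable_imp_hamiltonian
  unfolding chordal_bipartite_def by blast

end
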